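(* The following data form a category $\mathfrak{PB}$: objects are finite sets; for finite sets $X,Y$ the morphism set $\mathfrak{PB}(X,Y)$ is the set of all partitioned binary relations on $(X,Y)$; the composition $\mathfrak{PB}(Y,Z)\times\mathfrak{PB}(X,Y)\to\mathfrak{PB}(X,Z)$ is $(\beta,\alpha)\mapsto\beta\circ\alpha$; and the identity morphism of $X$ is $\varepsilon_X$. That is, $\circ$ is associative, and $\varepsilon_X\circ\alpha=\alpha$ for every $\alpha\in\mathfrak{PB}(Y,X)$ and $\beta\circ\varepsilon_X=\beta$ for every $\beta\in\mathfrak{PB}(X,Y)$.
   Context: For finite sets $X,Y$, a partitioned binary relation (PBR) on $(X,Y)$ is a binary relation $\alpha\subseteq (X\coprod Y)^2$ on the disjoint union $X\coprod Y$. $X$ is the domain and $Y$ the codomain of $\alpha$; pairs $(a,b)\in\alpha$ are called edges. If $X$ and $Y$ overlap (e.g. $X=Y$), $a^{(d)}$ and $a^{(c)}$ denote the element $a$ seen in the domain, respectively in the codomain. Composition: let $\alpha$ be a PBR on $(X,Y)$ and $\beta$ a PBR on $(Y,Z)$; regard the edges of both as pairs of elements of $X\coprod Y\coprod Z$. An $(\alpha,\beta)$-connected sequence is a finite nonempty sequence $(a_1,b_1),\dots,(a_m,b_m)$ of edges, each taken from $\alpha$ or from $\beta$ (one keeps track of which), such that no two successive edges are taken from the same PBR, and $b_i=a_{i+1}$ (as elements of $X\coprod Y\coprod Z$) for $i=1,\dots,m-1$; it is said to connect $a_1$ to $b_m$. The composition $\beta\circ\alpha$ is the PBR on $(X,Z)$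 such that, for $a,b\in X\coprod Z$, $(a,b)\in\beta\circ\alpha$ if and only if there is an $(\alpha,\beta)$-connected sequence connecting $a$ to $b$. For a finite set $X$, $\varepsilon_X$ is the PBR on $(X,X)$ consisting exactly of the edges $(x^{(d)},x^{(c)})$ and $(x^{(c)},x^{(d)})$ for all $x\in X$. *)

theory Defs
  imports Main
begin

text \<open>The disjoint union of two sets is \<^term>\<open>X <+> Y\<close>: for a relation on \<open>(X, Y)\<close>,
  \<^term>\<open>Inl x\<close> is an element seen in the domain and \<^term>\<open>Inr y\<close> one seen in the codomain.\<close>

type_synonym ('a, 'b) pbr = "(('a + 'b) \<times> ('a + 'b)) set"

definition pbrs :: "'a set \<Rightarrow> 'b set \<Rightarrow> ('a, 'b) pbr set" where
  "pbrs X Y = Pow ((X <+> Y) \<times> (X <+> Y))"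

text \<open>A connected sequence is a list of tagged edges, \<^term>\<open>Inl e\<close> for an edge taken from the
  first relation and \<^term>\<open>Inr e\<close> for one taken from the second. The endpoints of edges are
  compared in the triple disjoint union \<^typ>\<open>'a + 'b + 'c\<close>, which associates to the right; its
  outer parts \<open>'a\<close> and \<open>'c\<close> are reached through \<open>emb_outer\<close>.\<close>

type_synonym ('a, 'b, 'c) tagged_edge =
  "(('a + 'b) \<times> ('a + 'b)) + (('b + 'c) \<times> ('b + 'c))"

definition emb_fst :: "'a + 'b \<Rightarrow> 'a + 'b + 'c" where
  "emb_fst = map_sum id Inl"

definition emb_snd :: "'b + 'c \<Rightarrow> 'a + 'b + 'c" where
  "emb_snd = Inr"

definition emb_outer :: "'a + 'c \<Rightarrow> 'a + 'b + 'c" where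
  "emb_outer = map_sum id Inr"

definition edge_source :: "('a, 'b, 'c) tagged_edge \<Rightarrow> 'a + 'b + 'c" where
  "edge_source = case_sum (emb_fst \<circ> fst) (emb_snd \<circ> fst)"

definition edge_target :: "('a, 'b, 'c) tagged_edge \<Rightarrow> 'a + 'b + 'c" where
  "edge_target = case_sum (emb_fst \<circ> snd) (emb_snd \<circ> snd)"

definition connected_seq ::
  "('a, 'b) pbr \<Rightarrow> ('b, 'c) pbr \<Rightarrow> ('a, 'b, 'c) tagged_edge list \<Rightarrow> bool" where
  "connected_seq \<alpha> \<beta> es \<longleftrightarrow>
     es \<noteq> [] \<and> set es \<subseteq> \<alpha> <+> \<beta> \<and>
     (\<forall>i. Suc i < length es \<longrightarrow>
        isl (es ! i) \<noteq> isl (es ! Suc i) \<and> edge_target (es ! i) = edge_source (es ! Suc i))"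

definition connects :: "('a, 'b, 'c) tagged_edge list \<Rightarrow> 'a + 'b + 'c \<Rightarrow> 'a + 'b + 'c \<Rightarrow> bool" where
  "connects es a b \<longleftrightarrow> edge_source (hd es) = a \<and> edge_target (last es) = b"

text \<open>The underlying sets need not be arguments of the composition: for \<open>\<alpha>\<close> on \<open>(X, Y)\<close> and
  \<open>\<beta>\<close> on \<open>(Y, Z)\<close>, every end of an edge already lies in the disjoint union of \<open>X\<close>, \<open>Y\<close>, \<open>Z\<close>.\<close>

definition pbr_comp :: "('b, 'c) pbr \<Rightarrow> ('a, 'b) pbr \<Rightarrow> ('a, 'c) pbr"  (infixl "\<circ>\<^sub>P" 55) where
  "\<beta> \<circ>\<^sub>P \<alpha> =
     {(a, b). \<exists>es. connected_seq \<alpha> \<beta> es \<and> connects es (emb_outer a) (emb_outer b)}"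

definition pbr_id :: "'a set \<Rightarrow> ('a, 'a) pbr" where
  "pbr_id X = (\<Union>x\<in>X. {(Inl x, Inr x), (Inr x, Inl x)})"

text \<open>Categories are given by families of hom-sets, which need not be disjoint; composition is
  therefore indexed by the objects, \<open>comp X Y Z g f\<close> being the composite of
  \<open>f : X \<rightarrow> Y\<close> and \<open>g : Y \<rightarrow> Z\<close>.\<close>

locale category =
  fixes Obj :: "'o set"
    and Hom :: "'o \<Rightarrow> 'o \<Rightarrow> 'm set"
    and comp :: "'o \<Rightarrow> 'o \<Rightarrow> 'o \<Rightarrow> 'm \<Rightarrow> 'm \<Rightarrow> 'm"
    and Id :: "'o \<Rightarrow> 'm"
  assumes comp_closed:
      "\<lbrakk>X \<in> Obj; Y \<in> Obj; Z \<in> Obj; f \<in> Hom X Y; g \<in> Hom Y Z\<rbrakk> \<Longrightarrow> comp X Y Z g f \<in> Hom X Z"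
    and Id_closed: "X \<in> Obj \<Longrightarrow> Id X \<in> Hom X X"
    and comp_assoc:
      "\<lbrakk>X \<in> Obj; Y \<in> Obj; Z \<in> Obj; W \<in> Obj; f \<in> Hom X Y; g \<in> Hom Y Z; h \<in> Hom Z W\<rbrakk>
       \<Longrightarrow> comp X Y W (comp Y Z W h g) f = comp X Z W h (comp X Y Z g f)"
    and Id_left: "\<lbrakk>X \<in> Obj; Y \<in> Obj; f \<in> Hom X Y\<rbrakk> \<Longrightarrow> comp X Y Y (Id Y) f = f"
    and Id_right: "\<lbrakk>X \<in> Obj; Y \<in> Obj; f \<in> Hom X Y\<rbrakk> \<Longrightarrow> comp X X Y f (Id X) = f"

end

theory Submission
  imports Defs
begin

text \<open>Both ways of composing three relations describe the same walks: sequences of edges of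
  \<open>\<alpha>\<close>, \<open>\<beta>\<close>, \<open>\<gamma>\<close> in the disjoint union of \<open>X\<close>, \<open>Y\<close>, \<open>Z\<close>, \<open>W\<close>, successive edges coming from
  different relations, with ends outside \<open>Y\<close> and \<open>Z\<close>. A walk for \<open>\<gamma> \<circ>\<^sub>P (\<beta> \<circ>\<^sub>P \<alpha>)\<close>
  becomes such a sequence when its edges from \<open>\<beta> \<circ>\<^sub>P \<alpha>\<close> are replaced by walks for them.
  Conversely, cut a sequence of edges of \<open>\<alpha>\<close>, \<open>\<beta>\<close>, \<open>\<gamma>\<close> around the edges of \<open>\<gamma>\<close>: the cuts lie on ends of
  edges of \<open>\<gamma>\<close>, hence outside \<open>Y\<close>, so every piece between them is a walk for an
  edge of \<open>\<beta> \<circ>\<^sub>P \<alpha>\<close>.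

  This argument does not distinguish the first relation from the last, provided that all
  relations live on one set of vertices. There, composition becomes a \<open>junction\<close> of a family of
  relations along a set \<open>M\<close> of inner vertices. It depends on the family only up to
  reindexing (\<open>junction_reindex\<close>), and a junction of a junction with a relation that
  avoids the inner vertices is the junction of the enlarged family (\<open>junction_nested\<close>); associativity follows (\<open>junction_assoc\<close>). The link to \<^const>\<open>pbr_comp\<close>
  is \<open>transport_pbr_comp\<close>, which embeds a composite in any larger set of vertices.

  For the identity laws, an edge of \<open>\<epsilon>\<^sub>X\<close> only passes between the two
  copies of a point, so a walk between outer vertices uses exactly one edge of \<open>\<alpha>\<close>: the edge of \<open>\<epsilon>\<^sub>X\<close>
  that follows it leads to the outer copy of a point, where no edge of \<open>\<alpha>\<close> starts.
  The other identity law is its mirror image, since exchanging domains and codomains reverses composition.\<close>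

section \<open>Alternating walks and junctions\<close>

text \<open>The index is that of the relation providing the first edge.\<close>

inductive walk :: "('i \<Rightarrow> ('v \<times> 'v) set) \<Rightarrow> 'i \<Rightarrow> 'v \<Rightarrow> 'v \<Rightarrow> bool" for F where
  edge: "(u, v) \<in> F i \<Longrightarrow> walk F i u v"
| step: "(u, v) \<in> F i \<Longrightarrow> i \<noteq> j \<Longrightarrow> walk F j v w \<Longrightarrow> walk F i u w"

definition junction :: "'v set \<Rightarrow> ('i \<Rightarrow> ('v \<times> 'v) set) \<Rightarrow> ('v \<times> 'v) set" where
  "junction M F = {(u, v). u \<notin> M \<and> v \<notin> M \<and> (\<exists>i. walk F i u v)}"

abbreviation pair :: "'r \<Rightarrow> 'r \<Rightarrow> bool \<Rightarrow> 'r" where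
  "pair R S \<equiv> case_bool R S"

abbreviation transport :: "('v \<Rightarrow> 'w) \<Rightarrow> ('v \<times> 'v) set \<Rightarrow> ('w \<times> 'w) set" where
  "transport f R \<equiv> map_prod f f ` R"

lemma walk_source: "walk F i u v \<Longrightarrow> u \<in> Field (F i)"
  by (induction rule: walk.induct) (auto simp: Field_def)

lemma walk_Field:
  "walk F i u v \<Longrightarrow> u \<in> (\<Union>i. Field (F i)) \<and> v \<in> (\<Union>i. Field (F i))"
  by (induction rule: walk.induct) (auto simp: Field_def)

lemma walk_comp_index:
  assumes "inj \<pi>" "walk (F \<circ> \<pi>) i u v" shows "walk F (\<pi> i) u v"
  using assms(2) by induction (auto intro: walk.intros dest: injD[OF assms(1)])

lemma junction_reindex:
  assumes "bij \<pi>" shows "junction M (F \<circ> \<pi>) = junction M F"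
proof -
  have inj: "inj \<pi>" "inj (inv \<pi>)"
    using assms by (simp_all add: bij_is_inj bij_imp_bij_inv)
  have F: "(F \<circ> \<pi>) \<circ> inv \<pi> = F"
    using assms by (simp add: fun_eq_iff bij_is_surj surj_f_inv_f)
  have "(\<exists>i. walk (F \<circ> \<pi>) i u v) \<longleftrightarrow> (\<exists>i. walk F i u v)" for u v
    using walk_comp_index[OF inj(1), of F _ u v]
      walk_comp_index[OF inj(2), of "F \<circ> \<pi>" _ u v] unfolding F by metis
  then show ?thesis by (simp add: junction_def)
qed

lemma junction_commute: "junction M (pair R S) = junction M (pair S R)"
proof -
  have "bij Not" by (rule involuntory_imp_bij) simp
  moreover have "pair R S = pair S R \<circ> Not" by (auto simp: fun_eq_iff split: bool.split)
  ultimately show ?thesis by (metis junction_reindex)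
qed

text \<open>Concatenation across an edge of \<open>G\<close> needs no comparison of indices: \<open>G\<close> has the new index
  \<^const>\<open>None\<close>, which differs from the index of every edge of \<open>F\<close>.\<close>

lemma walk_append_new:
  "walk F i u v \<Longrightarrow> walk (case_option G F) None v w \<Longrightarrow> walk (case_option G F) (Some i) u w"
  by (induction rule: walk.induct) (auto intro: walk.intros)

lemma walk_Some: "walk F i u v \<Longrightarrow> walk (case_option G F) (Some i) u v"
  by (induction rule: walk.induct) (auto intro: walk.intros)

lemma walk_flatten:
  assumes "walk (pair (junction M F) G) b u w"
  shows "if b then \<exists>i. walk (case_option G F) (Some i) u w
         else walk (case_option G F) None u w"
  using assms
proof induction
  case (edge u v b)
  then show ?case by (cases b) (auto simp: junction_def intro: walk_Some walk.edge)
next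
  case (step u v b b' w)
  then show ?case
    by (cases b) (auto simp: junction_def intro: walk_append_new walk.step)
qed

text \<open>The induction runs from the end of the walk. A walk that starts with an edge of \<open>F\<close> is still
  inside a piece whose start, possibly in \<open>M\<close>, is not yet known, so the claim
  splits off the remainder of that piece.\<close>

lemma walk_cut:
  assumes "walk (case_option G F) k u w" and "Field G \<inter> M = {}" and "w \<notin> M"
  shows "case k of
      None \<Rightarrow> walk (pair (junction M F) G) False u w
    | Some i \<Rightarrow> \<exists>v. v \<notin> M \<and> walk F i u v \<and>
        (v = w \<or> walk (pair (junction M F) G) False v w)"
  using assms
proof induction
  case (edge u v k)
  then show ?case by (cases k) (auto intro: walk.edge)
next
  case (step u v k l w)
  show ?case
  proof (cases k)
    case None
    with step.hyps obtain j where l: "l = Some j" by (cases l) auto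
    with step obtain v' where v': "v' \<notin> M" "walk F j v v'"
      "v' = w \<or> walk (pair (junction M F) G) False v' w" by auto
    have uv: "(u, v) \<in> pair (junction M F) G False" using step.hyps None by simp
    then have "v \<notin> M" using step.prems by (auto simp: Field_def)
    then have "(v, v') \<in> pair (junction M F) G True" using v' by (auto simp: junction_def)
    then have "walk (pair (junction M F) G) True v w"
      using v'(3) by (auto intro: walk.edge walk.step[where j = False])
    with uv None show ?thesis by (auto intro: walk.step[where j = True])
  next
    case (Some i)
    show ?thesis
    proof (cases l)
      case None
      with step have w: "walk (pair (junction M F) G) False v w" by simp
      then have "v \<notin> M" using walk_source[OF w] step.prems by auto
      with w Some step.hyps show ?thesis by (auto intro: walk.edge)
    next
      fix j assume "l = Some j"
      with Some step show ?thesis by (auto intro: walk.step[where j = j])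
    qed
  qed
qed

text \<open>The hypothesis lets the cuts be made: they lie on ends of edges of \<open>G\<close>, and an edge of the
  inner junction must end outside \<open>M\<close>.\<close>

lemma junction_nested:
  assumes "Field G \<inter> M = {}"
  shows "junction N (pair (junction M F) G) = junction (M \<union> N) (case_option G F)"
proof (intro equalityI subrelI)
  fix u w assume a: "(u, w) \<in> junction N (pair (junction M F) G)"
  then obtain b where b: "walk (pair (junction M F) G) b u w" and N: "u \<notin> N" "w \<notin> N"
    by (auto simp: junction_def)
  have "Field (pair (junction M F) G b) \<inter> M = {}" for b
    using assms by (cases b) (auto simp: junction_def Field_def)
  then have "u \<notin> M \<and> w \<notin> M" using walk_Field[OF b] by blast
  moreover have "\<exists>k. walk (case_option G F) k u w"
    using walk_flatten[OF b] by (auto split: if_splits)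
  ultimately show "(u, w) \<in> junction (M \<union> N) (case_option G F)"
    using N by (simp add: junction_def)
next
  fix u w assume a: "(u, w) \<in> junction (M \<union> N) (case_option G F)"
  then obtain k where k: "walk (case_option G F) k u w"
    and out: "u \<notin> M" "w \<notin> M" "u \<notin> N" "w \<notin> N"
    by (auto simp: junction_def)
  have "\<exists>b. walk (pair (junction M F) G) b u w"
  proof (cases k)
    case None
    with walk_cut[OF k assms out(2)] show ?thesis by auto
  next
    case (Some i)
    with walk_cut[OF k assms out(2)] obtain v where v: "v \<notin> M" "walk F i u v"
      "v = w \<or> walk (pair (junction M F) G) False v w" by auto
    then have "(u, v) \<in> pair (junction M F) G True" using out by (auto simp: junction_def)
    then have "walk (pair (junction M F) G) True u w"
      using v(3) by (auto intro: walk.edge walk.step[where j = False])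
    then show ?thesis ..
  qed
  with out show "(u, w) \<in> junction N (pair (junction M F) G)" by (simp add: junction_def)
qed

text \<open>Both sides are the junction of the three relations along \<open>M \<union> N\<close>, with different indices.\<close>

lemma junction_assoc:
  assumes "Field T \<inter> M = {}" and "Field R \<inter> N = {}"
  shows "junction N (pair (junction M (pair R S)) T) = junction M (pair R (junction N (pair S T)))"
proof -
  \<comment> \<open>\<open>\<pi>\<close> matches the indices of \<open>T, R, S\<close> on the left with those of \<open>R, S, T\<close> on the right.\<close>
  define \<pi> :: "bool option \<Rightarrow> bool option"
    where "\<pi> = case_option (Some False) (case_bool None (Some True))"
  have "bij \<pi>"
  proof (rule bijI)
    show "inj \<pi>" by (auto simp: inj_def \<pi>_def split: option.split bool.split)
    show "surj \<pi>"
    proof (rule surjI)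
      fix x show "\<pi> (case x of None \<Rightarrow> Some True | Some b \<Rightarrow> if b then Some False else None) = x"
        by (auto simp: \<pi>_def split: option.split)
    qed
  qed
  moreover have "case_option T (pair R S) = case_option R (pair S T) \<circ> \<pi>"
    by (auto simp: \<pi>_def fun_eq_iff split: option.split bool.split)
  ultimately have "junction (M \<union> N) (case_option T (pair R S)) =
      junction (M \<union> N) (case_option R (pair S T))"
    by (simp only: junction_reindex)
  also have "\<dots> = junction M (pair (junction N (pair S T)) R)"
    by (simp only: junction_nested[OF assms(2)] Un_commute)
  also have "\<dots> = junction M (pair R (junction N (pair S T)))"
    by (rule junction_commute)
  finally show ?thesis by (simp only: junction_nested[OF assms(1)])
qed

section \<open>Composition as a junction\<close>

lemma emb_simps [simp]:
  "emb_fst (Inl a) = Inl a" "emb_fst (Inr b) = Inr (Inl b)" "emb_snd t = Inr t"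
  "emb_outer (Inl a) = Inl a" "emb_outer (Inr c) = Inr (Inr c)"
  by (simp_all add: emb_fst_def emb_snd_def emb_outer_def)

lemma connected_seq_Cons:
  "connected_seq \<alpha> \<beta> (e # es) \<longleftrightarrow> e \<in> \<alpha> <+> \<beta> \<and>
     (es = [] \<or> connected_seq \<alpha> \<beta> es \<and> isl e \<noteq> isl (hd es) \<and> edge_target e = edge_source (hd es))"
  by (cases es) (auto simp: connected_seq_def nth_Cons less_Suc_eq_0_disj split: nat.split)

lemma connected_seq_Nil: "\<not> connected_seq \<alpha> \<beta> []"
  by (simp add: connected_seq_def)

abbreviation embedded_edges ::
  "('a, 'b) pbr \<Rightarrow> ('b, 'c) pbr \<Rightarrow> bool \<Rightarrow> (('a + 'b + 'c) \<times> ('a + 'b + 'c)) set" where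
  "embedded_edges \<alpha> \<beta> \<equiv> pair (transport emb_fst \<alpha>) (transport emb_snd \<beta>)"

lemma embedded_edges_iff:
  "(u, v) \<in> embedded_edges \<alpha> \<beta> b \<longleftrightarrow>
     (\<exists>e \<in> \<alpha> <+> \<beta>. isl e = b \<and> edge_source e = u \<and> edge_target e = v)"
proof -
  have "(\<exists>e \<in> \<alpha> <+> \<beta>. P e) \<longleftrightarrow> (\<exists>e \<in> \<alpha>. P (Inl e)) \<or> (\<exists>e \<in> \<beta>. P (Inr e))"
    for P :: "('a, 'b, 'c) tagged_edge \<Rightarrow> bool" by auto
  then show ?thesis
    by (cases b) (simp_all add: edge_source_def edge_target_def image_iff map_prod_def
        case_prod_beta eq_commute)
qed

lemma walk_imp_connected_seq:
  "walk (embedded_edges \<alpha> \<beta>) b u v \<Longrightarrow>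
   \<exists>es. connected_seq \<alpha> \<beta> es \<and> connects es u v \<and> isl (hd es) = b"
proof (induction rule: walk.induct)
  case (edge u v b)
  then obtain e where e: "e \<in> \<alpha> <+> \<beta>" "isl e = b" "edge_source e = u" "edge_target e = v"
    unfolding embedded_edges_iff by blast
  then show ?case
    by (intro exI[of _ "[e]"]) (simp add: connected_seq_Cons connects_def)
next
  case (step u v b b' w)
  obtain e where e: "e \<in> \<alpha> <+> \<beta>" "isl e = b" "edge_source e = u" "edge_target e = v"
    using step.hyps unfolding embedded_edges_iff by blast
  obtain es where es: "connected_seq \<alpha> \<beta> es" "connects es v w" "isl (hd es) = b'"
    using step.IH by blast
  then have "es \<noteq> []" by (auto simp: connected_seq_Nil)
  with e es step.hyps show ?case
    by (intro exI[of _ "e # es"]) (simp add: connected_seq_Cons connects_def)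
qed

lemma connected_seq_imp_walk:
  "connected_seq \<alpha> \<beta> es \<Longrightarrow>
   walk (embedded_edges \<alpha> \<beta>) (isl (hd es)) (edge_source (hd es)) (edge_target (last es))"
proof (induction es)
  case Nil
  then show ?case by (simp add: connected_seq_Nil)
next
  case (Cons e es)
  then have e: "(edge_source e, edge_target e) \<in> embedded_edges \<alpha> \<beta> (isl e)"
    unfolding embedded_edges_iff connected_seq_Cons by blast
  show ?case
  proof (cases "es = []")
    case True
    then show ?thesis using walk.edge[of _ _ "embedded_edges \<alpha> \<beta>", OF e] by simp
  next
    case False
    with Cons walk.step[of _ _ "embedded_edges \<alpha> \<beta>", OF e] show ?thesis by (simp add: connected_seq_Cons)
  qed
qed

lemma pbr_comp_iff_walk:
  "(a, b) \<in> \<beta> \<circ>\<^sub>P \<alpha> \<longleftrightarrow> (\<exists>s. walk (embedded_edges \<alpha> \<beta>) s (emb_outer a) (emb_outer b))"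
proof
  assume "(a, b) \<in> \<beta> \<circ>\<^sub>P \<alpha>"
  then obtain es where "connected_seq \<alpha> \<beta> es" "connects es (emb_outer a) (emb_outer b)"
    by (auto simp: pbr_comp_def)
  then show "\<exists>s. walk (embedded_edges \<alpha> \<beta>) s (emb_outer a) (emb_outer b)"
    using connected_seq_imp_walk[of \<alpha> \<beta> es] unfolding connects_def by auto
next
  assume "\<exists>s. walk (embedded_edges \<alpha> \<beta>) s (emb_outer a) (emb_outer b)"
  then show "(a, b) \<in> \<beta> \<circ>\<^sub>P \<alpha>"
    unfolding pbr_comp_def using walk_imp_connected_seq by blast
qed

lemma walk_transport:
  "walk F i u v \<Longrightarrow> walk (\<lambda>i. transport f (F i)) i (f u) (f v)"
  by (induction rule: walk.induct) (auto intro: walk.intros)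

lemma walk_transportD:
  assumes "walk (\<lambda>i. transport f (F i)) i x y" and "inj f"
  shows "\<exists>u v. x = f u \<and> y = f v \<and> walk F i u v"
  using assms(1)
proof induction
  case (edge x y i)
  then show ?case by (auto intro: walk.edge)
next
  case (step x y i j z)
  from step.hyps(1) obtain u v where "x = f u" "y = f v" "(u, v) \<in> F i" by auto
  moreover from step.IH obtain v' w where "y = f v'" "z = f w" "walk F j v' w" by blast
  moreover from calculation have "v' = v" using assms(2) by (metis injD)
  ultimately show ?case using step.hyps(2) by (blast intro: walk.step)
qed

lemma transport_comp: "transport f (transport g R) = transport (f \<circ> g) R"
  by (simp add: image_comp map_prod.comp)

lemma not_range_emb_outer: "u \<notin> range emb_outer \<longleftrightarrow> u \<in> range (Inr \<circ> Inl)"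
proof -
  have "range emb_outer = range Inl \<union> range (Inr \<circ> Inr)"
    unfolding UNIV_sum image_Un image_image by simp
  then show ?thesis
    by (cases u; cases "projr u") auto
qed

text \<open>Composites of different pairs live on different types of vertices; a common type with
  embeddings \<open>f\<close> makes them comparable as junctions.\<close>

lemma transport_pbr_comp:
  assumes "inj f"
  shows "transport (f \<circ> emb_outer) (\<beta> \<circ>\<^sub>P \<alpha>) = junction (range (f \<circ> (Inr \<circ> Inl)))
    (pair (transport (f \<circ> emb_fst) \<alpha>) (transport (f \<circ> emb_snd) \<beta>))"
proof -
  have fam: "pair (transport (f \<circ> emb_fst) \<alpha>) (transport (f \<circ> emb_snd) \<beta>) =
      (\<lambda>s. transport f (embedded_edges \<alpha> \<beta> s))"
    by (simp add: fun_eq_iff transport_comp split: bool.split)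
  have outer: "f u \<notin> range (f \<circ> (Inr \<circ> Inl)) \<longleftrightarrow> u \<in> range emb_outer" for u
    using not_range_emb_outer[of u] injD[OF assms] by fastforce
  show ?thesis
  proof (intro equalityI subrelI)
    fix x y assume "(x, y) \<in> transport (f \<circ> emb_outer) (\<beta> \<circ>\<^sub>P \<alpha>)"
    then obtain a b where ab: "x = f (emb_outer a)" "y = f (emb_outer b)" "(a, b) \<in> \<beta> \<circ>\<^sub>P \<alpha>"
      by auto
    then obtain s where "walk (embedded_edges \<alpha> \<beta>) s (emb_outer a) (emb_outer b)"
      by (auto simp: pbr_comp_iff_walk)
    from walk_transport[OF this, of f] outer show "(x, y) \<in> junction (range (f \<circ> (Inr \<circ> Inl)))
        (pair (transport (f \<circ> emb_fst) \<alpha>) (transport (f \<circ> emb_snd) \<beta>))"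
      unfolding junction_def fam mem_Collect_eq prod.case ab by blast
  next
    fix x y assume "(x, y) \<in> junction (range (f \<circ> (Inr \<circ> Inl)))
        (pair (transport (f \<circ> emb_fst) \<alpha>) (transport (f \<circ> emb_snd) \<beta>))"
    then obtain s where s: "walk (\<lambda>s. transport f (embedded_edges \<alpha> \<beta> s)) s x y"
      and out: "x \<notin> range (f \<circ> (Inr \<circ> Inl))" "y \<notin> range (f \<circ> (Inr \<circ> Inl))"
      unfolding junction_def fam by blast
    from walk_transportD[OF s assms] obtain u v where
      uv: "x = f u" "y = f v" "walk (embedded_edges \<alpha> \<beta>) s u v" by blast
    with out outer obtain a b where ab: "u = emb_outer a" "v = emb_outer b" by blast
    with uv have "(a, b) \<in> \<beta> \<circ>\<^sub>P \<alpha>" by (auto simp: pbr_comp_iff_walk)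
    with uv ab show "(x, y) \<in> transport (f \<circ> emb_outer) (\<beta> \<circ>\<^sub>P \<alpha>)" by force
  qed
qed

lemma transport_inject: "inj f \<Longrightarrow> transport f R = transport f S \<longleftrightarrow> R = S"
  by (rule inj_image_eq_iff) (simp add: prod.inj_map)

section \<open>Associativity\<close>

lemma pbr_comp_assoc:
  fixes \<alpha> :: "('a, 'b) pbr" and \<beta> :: "('b, 'c) pbr" and \<gamma> :: "('c, 'd) pbr"
  shows "(\<gamma> \<circ>\<^sub>P \<beta>) \<circ>\<^sub>P \<alpha> = \<gamma> \<circ>\<^sub>P (\<beta> \<circ>\<^sub>P \<alpha>)"
proof -
  \<comment> \<open>The vertices of the four composites, embedded in \<open>'a + 'b + 'c + 'd\<close>.\<close>
  define abc :: "'a + 'b + 'c \<Rightarrow> 'a + 'b + 'c + 'd" where "abc = map_sum id (map_sum id Inl)"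
  define bcd :: "'b + 'c + 'd \<Rightarrow> 'a + 'b + 'c + 'd" where "bcd = Inr"
  define acd :: "'a + 'c + 'd \<Rightarrow> 'a + 'b + 'c + 'd" where "acd = map_sum id Inr"
  define abd :: "'a + 'b + 'd \<Rightarrow> 'a + 'b + 'c + 'd" where "abd = map_sum id (map_sum id Inr)"
  note defs = abc_def bcd_def acd_def abd_def
  have inj: "inj abc" "inj bcd" "inj acd" "inj abd"
    by (auto simp: defs intro!: sum.inj_map)
  define B C where "B = range (abc \<circ> (Inr \<circ> Inl))" and "C = range (acd \<circ> (Inr \<circ> Inl))"
  have BC: "B = range (abd \<circ> (Inr \<circ> Inl))" "C = range (bcd \<circ> (Inr \<circ> Inl))"
    by (auto simp: B_def C_def defs)
  have emb: "abd \<circ> emb_fst = abc \<circ> emb_fst" "acd \<circ> emb_snd = bcd \<circ> emb_snd"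
      "bcd \<circ> emb_fst = abc \<circ> emb_snd" "acd \<circ> emb_fst = abc \<circ> emb_outer"
      "abd \<circ> emb_snd = bcd \<circ> emb_outer" "abd \<circ> emb_outer = acd \<circ> emb_outer"
    by (simp_all add: defs emb_fst_def emb_snd_def emb_outer_def fun_eq_iff sum.map_comp o_def)
  define R S T where "R = transport (abc \<circ> emb_fst) \<alpha>" and "S = transport (abc \<circ> emb_snd) \<beta>"
    and "T = transport (bcd \<circ> emb_snd) \<gamma>"
  have sep: "Field T \<inter> B = {}" "Field R \<inter> C = {}"
  proof -
    have "(bcd \<circ> emb_snd) u \<notin> B" for u :: "'c + 'd"
      by (auto simp: B_def defs emb_snd_def)
    then show "Field T \<inter> B = {}" by (fastforce simp: T_def Field_def)
    have "(abc \<circ> emb_fst) u \<notin> C" for u :: "'a + 'b"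
      by (cases u) (auto simp: C_def defs emb_fst_def)
    then show "Field R \<inter> C = {}" by (fastforce simp: R_def Field_def)
  qed
  have "transport (acd \<circ> emb_outer) ((\<gamma> \<circ>\<^sub>P \<beta>) \<circ>\<^sub>P \<alpha>) = junction B (pair R (junction C (pair S T)))"
    using transport_pbr_comp[OF inj(4), of "\<gamma> \<circ>\<^sub>P \<beta>" \<alpha>] transport_pbr_comp[OF inj(2), of \<gamma> \<beta>]
    by (simp only: emb R_def S_def T_def flip: BC)
  also have "\<dots> = junction C (pair (junction B (pair R S)) T)"
    using junction_assoc[OF sep] by simp
  also have "\<dots> = transport (acd \<circ> emb_outer) (\<gamma> \<circ>\<^sub>P (\<beta> \<circ>\<^sub>P \<alpha>))"
    using transport_pbr_comp[OF inj(3), of \<gamma> "\<beta> \<circ>\<^sub>P \<alpha>"] transport_pbr_comp[OF inj(1), of \<beta> \<alpha>]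
    by (simp only: emb R_def S_def T_def flip: B_def C_def)
  finally have eq: "transport (acd \<circ> emb_outer) ((\<gamma> \<circ>\<^sub>P \<beta>) \<circ>\<^sub>P \<alpha>) =
      transport (acd \<circ> emb_outer) (\<gamma> \<circ>\<^sub>P (\<beta> \<circ>\<^sub>P \<alpha>))" .
  have "inj (emb_outer :: 'a + 'd \<Rightarrow> 'a + 'c + 'd)"
    by (auto simp: emb_outer_def intro!: sum.inj_map)
  then have "inj (acd \<circ> (emb_outer :: 'a + 'd \<Rightarrow> _))" by (rule inj_compose[OF inj(3)])
  with eq show ?thesis by (simp add: transport_inject del: o_apply)
qed

section \<open>Identities\<close>

fun swap_sum :: "'a + 'b \<Rightarrow> 'b + 'a" where
  "swap_sum (Inl a) = Inr a"
| "swap_sum (Inr b) = Inl b"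

lemma swap_sum_swap_sum: "swap_sum (swap_sum u) = u"
  by (cases u) simp_all

lemma inj_swap_sum: "inj swap_sum"
  by (rule inj_on_inverseI[of _ swap_sum]) (rule swap_sum_swap_sum)

text \<open>A junction ignores which of its two relations comes first, so only the embeddings of vertices
  distinguish the two sides.\<close>

lemma transport_swap_comp:
  fixes \<alpha> :: "('a, 'b) pbr" and \<beta> :: "('b, 'c) pbr"
  shows "transport swap_sum (\<beta> \<circ>\<^sub>P \<alpha>) = transport swap_sum \<alpha> \<circ>\<^sub>P transport swap_sum \<beta>"
proof -
  define f :: "'a + 'b + 'c \<Rightarrow> 'c + 'b + 'a"
    where "f = case_sum (Inr \<circ> Inr) (case_sum (Inr \<circ> Inl) Inl)"
  have "case_sum (Inr \<circ> Inr) (case_sum (Inr \<circ> Inl) Inl) (f u) = u" for u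
    unfolding f_def by (cases u; cases "projr u") auto
  then have f: "inj f" by (rule inj_on_inverseI)
  have mid: "f \<circ> (Inr \<circ> Inl) = Inr \<circ> Inl" by (simp add: f_def fun_eq_iff)
  have emb: "f \<circ> emb_fst = emb_snd \<circ> swap_sum" "f \<circ> emb_snd = emb_fst \<circ> swap_sum"
    "f \<circ> emb_outer = emb_outer \<circ> swap_sum"
    unfolding f_def fun_eq_iff by (simp_all add: split_sum_all)
  have "transport emb_outer (transport swap_sum (\<beta> \<circ>\<^sub>P \<alpha>)) = junction (range (Inr \<circ> Inl))
      (embedded_edges (transport swap_sum \<beta>) (transport swap_sum \<alpha>))"
    using transport_pbr_comp[OF f, of \<beta> \<alpha>]
    by (simp only: mid emb transport_comp
        junction_commute[of _ "transport (emb_snd \<circ> swap_sum) \<alpha>"])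
  also have "\<dots> = transport emb_outer (transport swap_sum \<alpha> \<circ>\<^sub>P transport swap_sum \<beta>)"
    using transport_pbr_comp[OF inj_on_id, of "transport swap_sum \<alpha>" "transport swap_sum \<beta>"]
    by simp
  finally show ?thesis
    by (subst (asm) transport_inject) (auto simp: emb_outer_def intro!: sum.inj_map)
qed

lemma eq_emb_fst_iff:
  "Inl a = emb_fst u \<longleftrightarrow> u = Inl a"
  "Inr (Inl b) = emb_fst u \<longleftrightarrow> u = Inr b"
  "Inr (Inr c) \<noteq> emb_fst u"
  by (cases u; auto)+

text \<open>A walk that starts with an edge of the identity has two forms: from the inner copy of a point
  it moves to the outer copy and ends there, and from the outer copy it moves to the inner one and
  continues with \<open>\<alpha>\<close>, because it cannot end at an inner vertex. The induction needs the inner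
  form for what follows an edge of \<open>\<alpha>\<close>.\<close>

lemma walk_identity:
  assumes "walk (embedded_edges \<alpha> (pbr_id X)) s u v" and "v = emb_outer b"
  shows "if s then \<exists>a. u = emb_fst a \<and> (a, b) \<in> \<alpha>
         else (\<exists>x. u = Inr (Inl x) \<and> b = Inr x) \<or> (\<exists>x. u = Inr (Inr x) \<and> (Inr x, b) \<in> \<alpha>)"
  using assms
proof induction
  case (edge u v s)
  then show ?case
    by (cases s; cases b) (auto simp: pbr_id_def eq_emb_fst_iff)
next
  case (step u v s s' w)
  show ?case
  proof (cases s)
    case True
    then obtain a c where ac: "(a, c) \<in> \<alpha>" "u = emb_fst a" "v = emb_fst c" using step.hyps by auto
    have "c = b" using step True ac by (cases c) auto
    with ac True show ?thesis by auto
  next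
    case False
    with step.hyps have s': s' by simp
    with step obtain a where a: "v = emb_fst a" "(a, b) \<in> \<alpha>" by auto
    from step.hyps False obtain x where
      "u = Inr (Inl x) \<and> v = Inr (Inr x) \<or> u = Inr (Inr x) \<and> v = Inr (Inl x)"
      by (auto simp: pbr_id_def)
    with a False show ?thesis by (cases a) auto
  qed
qed

lemma pbr_id_comp:
  assumes "\<alpha> \<in> pbrs Y X" shows "pbr_id X \<circ>\<^sub>P \<alpha> = \<alpha>"
proof (intro equalityI subrelI)
  fix a b assume "(a, b) \<in> pbr_id X \<circ>\<^sub>P \<alpha>"
  then obtain s where "walk (embedded_edges \<alpha> (pbr_id X)) s (emb_outer a) (emb_outer b)"
    by (auto simp: pbr_comp_iff_walk)
  from walk_identity[OF this refl] show "(a, b) \<in> \<alpha>"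
    by (cases a) (auto simp: eq_emb_fst_iff split: if_splits)
next
  fix a b assume ab: "(a, b) \<in> \<alpha>"
  let ?F = "embedded_edges \<alpha> (pbr_id X)"
  have mem: "a \<in> Y <+> X" "b \<in> Y <+> X" using assms ab by (auto simp: pbrs_def)
  have \<alpha>: "(emb_fst a, emb_fst b) \<in> ?F True" using ab by auto
  have out: "(Inr (Inl x), Inr (Inr x)) \<in> ?F False" "(Inr (Inr x), Inr (Inl x)) \<in> ?F False"
    if "x \<in> X" for x using that by (force simp: pbr_id_def)+
  have "walk ?F True (emb_fst a) (emb_outer b)"
  proof (cases b)
    case (Inl y)
    then show ?thesis using walk.edge[of _ _ ?F, OF \<alpha>] by simp
  next
    case (Inr x)
    then have "walk ?F False (emb_fst b) (emb_outer b)"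
      using mem out(1)[of x] by (auto intro!: walk.edge)
    then show ?thesis using walk.step[of _ _ ?F, OF \<alpha>] by blast
  qed
  then have "\<exists>s. walk ?F s (emb_outer a) (emb_outer b)"
  proof (cases a)
    case (Inl y)
    then show ?thesis using \<open>walk ?F True _ _\<close> by auto
  next
    case (Inr x)
    then have "(emb_outer a, emb_fst a) \<in> ?F False"
      using mem out(2)[of x] by auto
    from walk.step[of _ _ ?F, OF this _ \<open>walk ?F True _ _\<close>] show ?thesis by auto
  qed
  then show "(a, b) \<in> pbr_id X \<circ>\<^sub>P \<alpha>" by (simp add: pbr_comp_iff_walk)
qed

lemma transport_swap_pbr_id: "transport swap_sum (pbr_id X) = pbr_id X"
  by (force simp: pbr_id_def)

lemma pbr_comp_id:
  assumes "\<beta> \<in> pbrs X Y" shows "\<beta> \<circ>\<^sub>P pbr_id X = \<beta>"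
proof -
  have "swap_sum u \<in> Y <+> X" if "u \<in> X <+> Y" for u using that by auto
  then have "transport swap_sum \<beta> \<in> pbrs Y X"
    using assms unfolding pbrs_def by fastforce
  then have "transport swap_sum (\<beta> \<circ>\<^sub>P pbr_id X) = transport swap_sum \<beta>"
    by (simp only: transport_swap_comp transport_swap_pbr_id pbr_id_comp)
  then show ?thesis by (simp only: transport_inject[OF inj_swap_sum])
qed

section \<open>The category\<close>

lemma pbr_id_closed: "pbr_id X \<in> pbrs X X"
  by (auto simp: pbrs_def pbr_id_def)

lemma pbr_comp_closed:
  assumes "\<alpha> \<in> pbrs X Y" "\<beta> \<in> pbrs Y Z" shows "\<beta> \<circ>\<^sub>P \<alpha> \<in> pbrs X Z"
proof -
  have dom: "a \<in> X <+> Z" if "emb_outer a \<in> Field (embedded_edges \<alpha> \<beta> s)" for a s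
  proof -
    have "Field (embedded_edges \<alpha> \<beta> s) \<subseteq> emb_fst ` (X <+> Y) \<union> emb_snd ` (Y <+> Z)"
      using assms by (cases s) (auto simp: Field_def pbrs_def)
    with that show ?thesis
      by (cases a) auto
  qed
  show ?thesis
    unfolding pbrs_def
  proof (intro PowI subrelI)
    fix a b assume "(a, b) \<in> \<beta> \<circ>\<^sub>P \<alpha>"
    then obtain s where "walk (embedded_edges \<alpha> \<beta>) s (emb_outer a) (emb_outer b)"
      by (auto simp: pbr_comp_iff_walk)
    from walk_Field[OF this] show "(a, b) \<in> (X <+> Z) \<times> (X <+> Z)" by (blast intro: dom)
  qed
qed

theorem theorem3:
  shows "category {X :: 'u set. finite X} pbrs (\<lambda>X Y Z. pbr_comp) pbr_id \<and>
    (\<forall>(X :: 'a set) (Y :: 'b set) (Z :: 'c set). finite X \<longrightarrow> finite Y \<longrightarrow> finite Z \<longrightarrow>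
      (\<forall>\<alpha> \<in> pbrs X Y. \<forall>\<beta> \<in> pbrs Y Z. \<beta> \<circ>\<^sub>P \<alpha> \<in> pbrs X Z)) \<and>
    (\<forall>X :: 'a set. finite X \<longrightarrow> pbr_id X \<in> pbrs X X) \<and>
    (\<forall>(X :: 'a set) (Y :: 'b set) (Z :: 'c set) (W :: 'd set).
      finite X \<longrightarrow> finite Y \<longrightarrow> finite Z \<longrightarrow> finite W \<longrightarrow>
      (\<forall>\<alpha> \<in> pbrs X Y. \<forall>\<beta> \<in> pbrs Y Z. \<forall>\<gamma> \<in> pbrs Z W.
        (\<gamma> \<circ>\<^sub>P \<beta>) \<circ>\<^sub>P \<alpha> = \<gamma> \<circ>\<^sub>P (\<beta> \<circ>\<^sub>P \<alpha>))) \<and>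
    (\<forall>(X :: 'a set) (Y :: 'b set). finite X \<longrightarrow> finite Y \<longrightarrow>
      (\<forall>\<alpha> \<in> pbrs Y X. pbr_id X \<circ>\<^sub>P \<alpha> = \<alpha>) \<and>
      (\<forall>\<beta> \<in> pbrs X Y. \<beta> \<circ>\<^sub>P pbr_id X = \<beta>))"
  by (auto intro!: category.intro pbr_comp_closed pbr_id_closed pbr_comp_assoc pbr_id_comp pbr_comp_id)

end
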